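(* Let $S=\{18,26,30,59,68,70,87,90,91,93,96,99,100\}$. For every $n$ with $1\le n\le 100$ and $n\notin S$, the center $X_n$ lies inside angle $A$ in every isosceles triangle $ABC$ with $b=c>a$. For each $n\in S$, it is not the case that $X_n$ lies inside angle $A$ in every such triangle.
   Context: $X_n$ denotes the $n$-th triangle center listed in Kimberling's Encyclopedia of Triangle Centers (ETC), given by barycentric coordinates in terms of $a=BC$, $b=CA$, $c=AB$. A point is inside angle $A$ if it lies in the open convex region bounded by the rays $AB$ and $AC$; for a point with barycentric coordinates $(u:v:w)$ this holds iff $v(u+v+w)>0$ and $w(u+v+w)>0$. *)

theory Defs
  imports Complex_Main
begin

text \<open>
  Side lengths a = BC, b = CA, c = AB.  Every ETC centre X(n) is encoded by the first
  barycentric coordinate as a quotient  f(a,b,c) / g(a,b,c)  (as listed in ETC); the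
  remaining coordinates are obtained by cyclic permutation (a,b,c) -> (b,c,a) -> (c,a,b).
  To avoid division by zero, the triple of coordinates is taken in the homogeneous,
  denominator-cleared form  (f_A g_B g_C : f_B g_C g_A : f_C g_A g_B), which is the same
  projective point whenever all denominators are nonzero.
\<close>

type_synonym etc_entry = "(real \<Rightarrow> real \<Rightarrow> real \<Rightarrow> real) \<times> (real \<Rightarrow> real \<Rightarrow> real \<Rightarrow> real)"

definition SA :: "real \<Rightarrow> real \<Rightarrow> real \<Rightarrow> real" where
  "SA a b c = (b^2 + c^2 - a^2) / 2"

text \<open>Conway symbol S = twice the area of the triangle (Heron)\<close>
definition Sr :: "real \<Rightarrow> real \<Rightarrow> real \<Rightarrow> real" where
  "Sr a b c = sqrt ((a+b+c)*(-a+b+c)*(a-b+c)*(a+b-c)) / 2"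

text \<open>The angle A opposite side a (law of cosines); angle B is angA b c a, angle C is angA c a b.\<close>
definition angA :: "real \<Rightarrow> real \<Rightarrow> real \<Rightarrow> real" where
  "angA a b c = arccos ((b^2 + c^2 - a^2) / (2*b*c))"

definition bary_of :: "etc_entry \<Rightarrow> real \<Rightarrow> real \<Rightarrow> real \<Rightarrow> real \<times> real \<times> real" where
  "bary_of e a b c =
     (let f = fst e; g = snd e in
       (f a b c * g b c a * g c a b,
        f b c a * g c a b * g a b c,
        f c a b * g a b c * g b c a))"

definition inside_angle_A :: "real \<times> real \<times> real \<Rightarrow> bool" where
  "inside_angle_A p = (case p of (u, v, w) \<Rightarrow> v * (u+v+w) > 0 \<and> w * (u+v+w) > 0)"

definition etc1 :: etc_entry where
  "etc1 = (\<lambda>a b c. a, \<lambda>a b c. 1)"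

definition etc2 :: etc_entry where
  "etc2 = (\<lambda>a b c. 1, \<lambda>a b c. 1)"

definition etc3 :: etc_entry where
  "etc3 = (\<lambda>a b c. a^2*(SA a b c), \<lambda>a b c. 1)"

definition etc4 :: etc_entry where
  "etc4 = (\<lambda>a b c. 1, \<lambda>a b c. (SA a b c))"

definition etc5 :: etc_entry where
  "etc5 = (\<lambda>a b c. (Sr a b c)^2+(SA b c a)*(SA c a b), \<lambda>a b c. 1)"

definition etc6 :: etc_entry where
  "etc6 = (\<lambda>a b c. a^2, \<lambda>a b c. 1)"

definition etc7 :: etc_entry where
  "etc7 = (\<lambda>a b c. 1, \<lambda>a b c. b+c-a)"

definition etc8 :: etc_entry where
  "etc8 = (\<lambda>a b c. b+c-a, \<lambda>a b c. 1)"

definition etc9 :: etc_entry where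
  "etc9 = (\<lambda>a b c. a*(b+c-a), \<lambda>a b c. 1)"

definition etc10 :: etc_entry where
  "etc10 = (\<lambda>a b c. b+c, \<lambda>a b c. 1)"

definition etc11 :: etc_entry where
  "etc11 = (\<lambda>a b c. (b-c)^2*(b+c-a), \<lambda>a b c. 1)"

definition etc12 :: etc_entry where
  "etc12 = (\<lambda>a b c. (b+c)^2, \<lambda>a b c. b+c-a)"

definition etc13 :: etc_entry where
  "etc13 = (\<lambda>a b c. a, \<lambda>a b c. sin((angA a b c)+pi/3))"

definition etc14 :: etc_entry where
  "etc14 = (\<lambda>a b c. a, \<lambda>a b c. sin((angA a b c)-pi/3))"

definition etc15 :: etc_entry where
  "etc15 = (\<lambda>a b c. a*sin((angA a b c)+pi/3), \<lambda>a b c. 1)"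

definition etc16 :: etc_entry where
  "etc16 = (\<lambda>a b c. a*sin((angA a b c)-pi/3), \<lambda>a b c. 1)"

definition etc17 :: etc_entry where
  "etc17 = (\<lambda>a b c. a, \<lambda>a b c. sin((angA a b c)+pi/6))"

definition etc18 :: etc_entry where
  "etc18 = (\<lambda>a b c. a, \<lambda>a b c. sin((angA a b c)-pi/6))"

definition etc19 :: etc_entry where
  "etc19 = (\<lambda>a b c. a, \<lambda>a b c. (SA a b c))"

definition etc20 :: etc_entry where
  "etc20 = (\<lambda>a b c. 3*a^4-2*a^2*(b^2+c^2)-(b^2-c^2)^2, \<lambda>a b c. 1)"

definition etc21 :: etc_entry where
  "etc21 = (\<lambda>a b c. a*(a+b)*(a+c)*(b+c-a), \<lambda>a b c. 1)"

definition etc22 :: etc_entry where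
  "etc22 = (\<lambda>a b c. a^2*(b^4+c^4-a^4), \<lambda>a b c. 1)"

definition etc23 :: etc_entry where
  "etc23 = (\<lambda>a b c. a^2*(b^4+c^4-a^4-b^2*c^2), \<lambda>a b c. 1)"

definition etc24 :: etc_entry where
  "etc24 = (\<lambda>a b c. a*cos(2*(angA a b c)), \<lambda>a b c. cos((angA a b c)))"

definition etc25 :: etc_entry where
  "etc25 = (\<lambda>a b c. a^2, \<lambda>a b c. (SA a b c))"

definition etc26 :: etc_entry where
  "etc26 = (\<lambda>a b c. a^2*(b^2*cos(2*(angA b c a))+c^2*cos(2*(angA c a b))-a^2*cos(2*(angA a b c))), \<lambda>a b c. 1)"

definition etc27 :: etc_entry where
  "etc27 = (\<lambda>a b c. 1, \<lambda>a b c. (b+c)*(SA a b c))"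

definition etc28 :: etc_entry where
  "etc28 = (\<lambda>a b c. a, \<lambda>a b c. (b+c)*(SA a b c))"

definition etc29 :: etc_entry where
  "etc29 = (\<lambda>a b c. a, \<lambda>a b c. cos((angA a b c))*(cos((angA b c a))+cos((angA c a b))))"

definition etc30 :: etc_entry where
  "etc30 = (\<lambda>a b c. 2*a^4-a^2*(b^2+c^2)-(b^2-c^2)^2, \<lambda>a b c. 1)"

definition etc31 :: etc_entry where
  "etc31 = (\<lambda>a b c. a^3, \<lambda>a b c. 1)"

definition etc32 :: etc_entry where
  "etc32 = (\<lambda>a b c. a^4, \<lambda>a b c. 1)"

definition etc33 :: etc_entry where
  "etc33 = (\<lambda>a b c. a*(1+1/cos((angA a b c))), \<lambda>a b c. 1)"

definition etc34 :: etc_entry where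
  "etc34 = (\<lambda>a b c. a*(1-1/cos((angA a b c))), \<lambda>a b c. 1)"

definition etc35 :: etc_entry where
  "etc35 = (\<lambda>a b c. a^2*(b^2+c^2-a^2+b*c), \<lambda>a b c. 1)"

definition etc36 :: etc_entry where
  "etc36 = (\<lambda>a b c. a^2*(b^2+c^2-a^2-b*c), \<lambda>a b c. 1)"

definition etc37 :: etc_entry where
  "etc37 = (\<lambda>a b c. a*(b+c), \<lambda>a b c. 1)"

definition etc38 :: etc_entry where
  "etc38 = (\<lambda>a b c. a*(b^2+c^2), \<lambda>a b c. 1)"

definition etc39 :: etc_entry where
  "etc39 = (\<lambda>a b c. a^2*(b^2+c^2), \<lambda>a b c. 1)"

definition etc40 :: etc_entry where
  "etc40 = (\<lambda>a b c. a*(a^3+a^2*(b+c)-a*(b+c)^2-(b+c)*(b-c)^2), \<lambda>a b c. 1)"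

definition etc41 :: etc_entry where
  "etc41 = (\<lambda>a b c. a^3*(b+c-a), \<lambda>a b c. 1)"

definition etc42 :: etc_entry where
  "etc42 = (\<lambda>a b c. a^2*(b+c), \<lambda>a b c. 1)"

definition etc43 :: etc_entry where
  "etc43 = (\<lambda>a b c. a*(a*b+a*c-b*c), \<lambda>a b c. 1)"

definition etc44 :: etc_entry where
  "etc44 = (\<lambda>a b c. a*(b+c-2*a), \<lambda>a b c. 1)"

definition etc45 :: etc_entry where
  "etc45 = (\<lambda>a b c. a*(2*b+2*c-a), \<lambda>a b c. 1)"

definition etc46 :: etc_entry where
  "etc46 = (\<lambda>a b c. a*(cos((angA b c a))+cos((angA c a b))-cos((angA a b c))), \<lambda>a b c. 1)"

definition etc47 :: etc_entry where
  "etc47 = (\<lambda>a b c. a*cos(2*(angA a b c)), \<lambda>a b c. 1)"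

definition etc48 :: etc_entry where
  "etc48 = (\<lambda>a b c. a*sin(2*(angA a b c)), \<lambda>a b c. 1)"

definition etc49 :: etc_entry where
  "etc49 = (\<lambda>a b c. a*cos(3*(angA a b c)), \<lambda>a b c. 1)"

definition etc50 :: etc_entry where
  "etc50 = (\<lambda>a b c. a*sin(3*(angA a b c)), \<lambda>a b c. 1)"

definition etc51 :: etc_entry where
  "etc51 = (\<lambda>a b c. a^2*((Sr a b c)^2+(SA b c a)*(SA c a b)), \<lambda>a b c. 1)"

definition etc52 :: etc_entry where
  "etc52 = (\<lambda>a b c. a*cos(2*(angA a b c))*cos((angA b c a)-(angA c a b)), \<lambda>a b c. 1)"

definition etc53 :: etc_entry where
  "etc53 = (\<lambda>a b c. a*tan((angA a b c))*cos((angA b c a)-(angA c a b)), \<lambda>a b c. 1)"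

definition etc54 :: etc_entry where
  "etc54 = (\<lambda>a b c. a, \<lambda>a b c. cos((angA b c a)-(angA c a b)))"

definition etc55 :: etc_entry where
  "etc55 = (\<lambda>a b c. a^2*(b+c-a), \<lambda>a b c. 1)"

definition etc56 :: etc_entry where
  "etc56 = (\<lambda>a b c. a^2, \<lambda>a b c. b+c-a)"

definition etc57 :: etc_entry where
  "etc57 = (\<lambda>a b c. a, \<lambda>a b c. b+c-a)"

definition etc58 :: etc_entry where
  "etc58 = (\<lambda>a b c. a^2, \<lambda>a b c. b+c)"

definition etc59 :: etc_entry where
  "etc59 = (\<lambda>a b c. a^2, \<lambda>a b c. (b-c)^2*(b+c-a))"

definition etc60 :: etc_entry where
  "etc60 = (\<lambda>a b c. a^2*(b+c-a), \<lambda>a b c. (b+c)^2)"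

definition etc61 :: etc_entry where
  "etc61 = (\<lambda>a b c. a*sin((angA a b c)+pi/6), \<lambda>a b c. 1)"

definition etc62 :: etc_entry where
  "etc62 = (\<lambda>a b c. a*sin((angA a b c)-pi/6), \<lambda>a b c. 1)"

definition etc63 :: etc_entry where
  "etc63 = (\<lambda>a b c. a*(SA a b c), \<lambda>a b c. 1)"

definition etc64 :: etc_entry where
  "etc64 = (\<lambda>a b c. a^2, \<lambda>a b c. 3*a^4-2*a^2*(b^2+c^2)-(b^2-c^2)^2)"

definition etc65 :: etc_entry where
  "etc65 = (\<lambda>a b c. a*(b+c), \<lambda>a b c. b+c-a)"

definition etc66 :: etc_entry where
  "etc66 = (\<lambda>a b c. 1, \<lambda>a b c. b^4+c^4-a^4)"

definition etc67 :: etc_entry where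
  "etc67 = (\<lambda>a b c. 1, \<lambda>a b c. b^4+c^4-a^4-b^2*c^2)"

definition etc68 :: etc_entry where
  "etc68 = (\<lambda>a b c. a*cos((angA a b c)), \<lambda>a b c. cos(2*(angA a b c)))"

definition etc69 :: etc_entry where
  "etc69 = (\<lambda>a b c. (SA a b c), \<lambda>a b c. 1)"

definition etc70 :: etc_entry where
  "etc70 = (\<lambda>a b c. 1, \<lambda>a b c. b^2*cos(2*(angA b c a))+c^2*cos(2*(angA c a b))-a^2*cos(2*(angA a b c)))"

definition etc71 :: etc_entry where
  "etc71 = (\<lambda>a b c. a^2*(b+c)*(SA a b c), \<lambda>a b c. 1)"

definition etc72 :: etc_entry where
  "etc72 = (\<lambda>a b c. a*(b+c)*(SA a b c), \<lambda>a b c. 1)"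

definition etc73 :: etc_entry where
  "etc73 = (\<lambda>a b c. a^2*(b+c)*(SA a b c), \<lambda>a b c. b+c-a)"

definition etc74 :: etc_entry where
  "etc74 = (\<lambda>a b c. a^2, \<lambda>a b c. 2*a^4-a^2*(b^2+c^2)-(b^2-c^2)^2)"

definition etc75 :: etc_entry where
  "etc75 = (\<lambda>a b c. 1, \<lambda>a b c. a)"

definition etc76 :: etc_entry where
  "etc76 = (\<lambda>a b c. 1, \<lambda>a b c. a^2)"

definition etc77 :: etc_entry where
  "etc77 = (\<lambda>a b c. a, \<lambda>a b c. 1+1/cos((angA a b c)))"

definition etc78 :: etc_entry where
  "etc78 = (\<lambda>a b c. a, \<lambda>a b c. 1-1/cos((angA a b c)))"

definition etc79 :: etc_entry where
  "etc79 = (\<lambda>a b c. 1, \<lambda>a b c. b^2+c^2-a^2+b*c)"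

definition etc80 :: etc_entry where
  "etc80 = (\<lambda>a b c. 1, \<lambda>a b c. b^2+c^2-a^2-b*c)"

definition etc81 :: etc_entry where
  "etc81 = (\<lambda>a b c. a, \<lambda>a b c. b+c)"

definition etc82 :: etc_entry where
  "etc82 = (\<lambda>a b c. a, \<lambda>a b c. b^2+c^2)"

definition etc83 :: etc_entry where
  "etc83 = (\<lambda>a b c. 1, \<lambda>a b c. b^2+c^2)"

definition etc84 :: etc_entry where
  "etc84 = (\<lambda>a b c. a, \<lambda>a b c. a^3+a^2*(b+c)-a*(b+c)^2-(b+c)*(b-c)^2)"

definition etc85 :: etc_entry where
  "etc85 = (\<lambda>a b c. 1, \<lambda>a b c. a*(b+c-a))"

definition etc86 :: etc_entry where
  "etc86 = (\<lambda>a b c. 1, \<lambda>a b c. b+c)"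

definition etc87 :: etc_entry where
  "etc87 = (\<lambda>a b c. a, \<lambda>a b c. a*b+a*c-b*c)"

definition etc88 :: etc_entry where
  "etc88 = (\<lambda>a b c. a, \<lambda>a b c. b+c-2*a)"

definition etc89 :: etc_entry where
  "etc89 = (\<lambda>a b c. a, \<lambda>a b c. 2*b+2*c-a)"

definition etc90 :: etc_entry where
  "etc90 = (\<lambda>a b c. a, \<lambda>a b c. cos((angA b c a))+cos((angA c a b))-cos((angA a b c)))"

definition etc91 :: etc_entry where
  "etc91 = (\<lambda>a b c. a, \<lambda>a b c. cos(2*(angA a b c)))"

definition etc92 :: etc_entry where
  "etc92 = (\<lambda>a b c. a, \<lambda>a b c. sin(2*(angA a b c)))"

definition etc93 :: etc_entry where
  "etc93 = (\<lambda>a b c. a, \<lambda>a b c. cos(3*(angA a b c)))"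

definition etc94 :: etc_entry where
  "etc94 = (\<lambda>a b c. a, \<lambda>a b c. sin(3*(angA a b c)))"

definition etc95 :: etc_entry where
  "etc95 = (\<lambda>a b c. 1, \<lambda>a b c. (Sr a b c)^2+(SA b c a)*(SA c a b))"

definition etc96 :: etc_entry where
  "etc96 = (\<lambda>a b c. a, \<lambda>a b c. cos(2*(angA a b c))*cos((angA b c a)-(angA c a b)))"

definition etc97 :: etc_entry where
  "etc97 = (\<lambda>a b c. a, \<lambda>a b c. tan((angA a b c))*cos((angA b c a)-(angA c a b)))"

definition etc98 :: etc_entry where
  "etc98 = (\<lambda>a b c. 1, \<lambda>a b c. b^4+c^4-a^2*b^2-a^2*c^2)"

definition etc99 :: etc_entry where
  "etc99 = (\<lambda>a b c. 1, \<lambda>a b c. b^2-c^2)"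

definition etc100 :: etc_entry where
  "etc100 = (\<lambda>a b c. a, \<lambda>a b c. b-c)"

definition etc_table :: "etc_entry list" where
  "etc_table = [etc1, etc2, etc3, etc4, etc5, etc6, etc7, etc8, etc9, etc10, etc11, etc12, etc13, etc14, etc15, etc16, etc17, etc18, etc19, etc20, etc21, etc22, etc23, etc24, etc25, etc26, etc27, etc28, etc29, etc30, etc31, etc32, etc33, etc34, etc35, etc36, etc37, etc38, etc39, etc40, etc41, etc42, etc43, etc44, etc45, etc46, etc47, etc48, etc49, etc50, etc51, etc52, etc53, etc54, etc55, etc56, etc57, etc58, etc59, etc60, etc61, etc62, etc63, etc64, etc65, etc66, etc67, etc68, etc69, etc70, etc71, etc72, etc73, etc74, etc75, etc76, etc77, etc78, etc79, etc80, etc81, etc82, etc83, etc84, etc85, etc86, etc87, etc88, etc89, etc90, etc91, etc92, etc93, etc94, etc95, etc96, etc97, etc98, etc99, etc100]"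

definition ETC :: "nat \<Rightarrow> real \<Rightarrow> real \<Rightarrow> real \<Rightarrow> real \<times> real \<times> real" where
  "ETC n a b c = bary_of (etc_table ! (n - 1)) a b c"

end

theory Submission
  imports Defs
begin

text \<open>
  In a triangle with \<open>b = c\<close> write the numerators and denominators of a centre as \<open>p\<close>, \<open>r\<close>
  at A and \<open>q\<close>, \<open>s\<close> at B and C. The centre lies inside angle A as soon as \<open>s \<noteq> 0\<close> and
  \<open>q r\<close> and \<open>p s + 2 q r\<close> have the same sign. With base angle \<open>\<theta>\<close>, the condition \<open>a < b\<close> means
  \<open>\<pi>/3 < \<theta> < \<pi>/2\<close>, so that \<open>a = 2 b cos \<theta>\<close> and \<open>A = \<pi> - 2 \<theta>\<close>; every entry becomes a polynomial
  in the sides or in trigonometric values of fixed sign, and \<open>p s + 2 q r\<close> factors into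
  terms of evident sign. Each exceptional centre other than X(30) has a triangle
  in which its second coordinate vanishes.
\<close>

section \<open>Sign criteria for isosceles triangles\<close>

text \<open>For \<open>b = c\<close> the cleared triple is \<open>(p s^2, q r s, q r s)\<close>, so
  the second and third coordinates, times the coordinate sum, both equal
  \<open>s^2 * (q r (p s + 2 q r))\<close>.\<close>

lemma inside_angle_A_isosceles:
  assumes "f a b b = p" "f b b a = q" "f b a b = q"
    and "g a b b = r" "g b b a = s" "g b a b = s"
    and "s \<noteq> 0" "0 < q * r * (p * s + 2 * q * r)"
  shows "inside_angle_A (bary_of (f, g) a b b)"
proof -
  have "0 < s^2 * (q * r * (p * s + 2 * q * r))"
    using assms by (intro mult_pos_pos[of "s^2"]) auto
  then show ?thesis
    by (simp add: inside_angle_A_def bary_of_def assms(1-6) power2_eq_square algebra_simps)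
qed

text \<open>The extra variable \<open>t\<close> lets a caller supply a factored form of
  \<open>p s + 2 q r\<close> whose sign is visible, leaving the factorisation as a separate
  identity.\<close>

lemma inside_angle_A_pos:
  assumes "f a b b = p" "f b b a = q" "f b a b = q"
    and "g a b b = r" "g b b a = s" "g b a b = s" "s \<noteq> 0"
    and "p * s + 2 * q * r = t" "0 < q * r" "0 < t"
  shows "inside_angle_A (bary_of (f, g) a b b)"
  using assms by (intro inside_angle_A_isosceles[of f a b p q g r s]) auto

lemma inside_angle_A_neg:
  assumes "f a b b = p" "f b b a = q" "f b a b = q"
    and "g a b b = r" "g b b a = s" "g b a b = s" "s \<noteq> 0"
    and "p * s + 2 * q * r = t" "q * r < 0" "t < 0"
  shows "inside_angle_A (bary_of (f, g) a b b)"
  using assms by (intro inside_angle_A_isosceles[of f a b p q g r s]) (auto simp: mult_neg_neg)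

text \<open>The numerator at A may be zero: for X(11) it contains \<open>(b-c)^2\<close>.\<close>

lemma inside_angle_A_nonneg:
  assumes "f b a b = f b b a" "g b a b = g b b a"
    and "0 \<le> f a b b" "0 < f b b a" "0 < g a b b" "0 < g b b a"
  shows "inside_angle_A (bary_of (f, g) a b b)"
proof -
  have "0 < f a b b * g b b a + 2 * f b b a * g a b b"
    using assms by (intro add_nonneg_pos) auto
  with assms show ?thesis
    by (intro inside_angle_A_pos[OF refl refl _ refl refl _ _ refl]) auto
qed

lemma inside_angle_A_neg_denominators:
  assumes "f b a b = f b b a" "g a b b = r" "g b b a = s" "g b a b = s"
    and "0 < f a b b" "0 < f b b a" "r < 0" "s < 0"
  shows "inside_angle_A (bary_of (f, g) a b b)"
proof -
  have "f a b b * s + 2 * f b b a * r < 0"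
    using assms by (intro add_neg_neg mult_pos_neg) auto
  with assms show ?thesis
    by (intro inside_angle_A_neg[OF refl refl _ refl refl _ _ refl]) (auto simp: mult_pos_neg)
qed

text \<open>The hypothesis says that the second coordinate \<open>v\<close> is zero.\<close>

lemma not_inside_angle_A:
  assumes "f b b a * g b a b * g a b b = 0"
  shows "\<not> inside_angle_A (bary_of (f, g) a b b)"
  unfolding inside_angle_A_def bary_of_def using assms by auto

section \<open>Centres given by polynomials in the sides\<close>

context
  fixes a b :: real
  assumes ab: "0 < a" "a < b"
begin

lemma sides_less:
  "0 < b" "a^2 < b^2" "a^4 < b^4" "a * b < b^2" "a^2 < a * b" "0 < a^2" "0 < a^4"
proof -
  show "a^2 < b^2" "a^4 < b^4"
    using ab by (simp_all add: power_strict_mono)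
  show "0 < b" "a * b < b^2" "a^2 < a * b" "0 < a^2" "0 < a^4"
    using ab by (simp_all add: power2_eq_square)
qed

text \<open>These are signs of factors met in the entries; the last one is
  \<open>b^2+c^2-a^2+b*c\<close> from X(35) and X(79) at \<open>b = c\<close>.\<close>

lemma side_bounds:
  "a^2 < 2 * b^2" "3 * a^2 < 4 * b^2" "a^2 < 4 * b^2" "a^4 < 2 * b^4"
  "0 < 2 * b^2 + a^2" "a^2 + 2 * a * b < 4 * b^2" "a * b < 2 * a^2 + 2 * b^2"
  "0 < b * b + (2 * b^2 - a^2)"
  using sides_less power2_eq_square[of b] by linarith+

text \<open>A triangle with \<open>b = c > a\<close> is acute.\<close>

lemma SA_pos: "0 < SA a b b" "0 < SA b b a" "0 < SA b a b"
  using side_bounds ab by (auto simp: SA_def)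

lemma SA_base: "SA b a b = SA b b a"
  by (simp add: SA_def)

lemma Sr_base: "Sr b b a = Sr a b b" "Sr b a b = Sr a b b"
  by (auto simp: Sr_def mult_ac add_ac)

lemmas side_facts =
  side_bounds side_bounds[THEN less_imp_le] SA_pos less_imp_le[OF SA_pos(1)] SA_base Sr_base

lemma inside_nonneg_entries:
  "\<forall>e\<in>{etc1, etc2, etc3, etc4, etc5, etc6, etc7, etc8, etc9, etc10, etc11, etc12,
    etc19, etc21, etc22, etc25, etc27, etc28, etc31, etc32, etc35, etc37, etc38, etc39, etc41,
    etc42, etc45, etc51, etc55, etc56, etc57, etc58, etc60, etc63, etc65, etc66, etc69, etc71,
    etc72, etc73, etc75, etc76, etc79, etc81, etc82, etc83, etc85, etc86, etc89, etc95}.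
    inside_angle_A (bary_of e a b b)"
  unfolding ball_simps etc1_def etc2_def etc3_def etc4_def etc5_def etc6_def etc7_def etc8_def
    etc9_def etc10_def etc11_def etc12_def etc19_def etc21_def etc22_def etc25_def etc27_def
    etc28_def etc31_def etc32_def etc35_def etc37_def etc38_def etc39_def etc41_def etc42_def
    etc45_def etc51_def etc55_def etc56_def etc57_def etc58_def etc60_def etc63_def etc65_def
    etc66_def etc69_def etc71_def etc72_def etc73_def etc75_def etc76_def etc79_def etc81_def
    etc82_def etc83_def etc85_def etc86_def etc89_def etc95_def
  by (intro conjI TrueI; rule inside_angle_A_nonneg;
    (insert ab sides_less, simp add: mult.commute add.commute side_facts power2_commute
      add_nonneg_pos))

text \<open>The instantiation lists the values at A (\<open>p\<close>, \<open>r\<close>) and at B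
  and C (\<open>q\<close>, \<open>s\<close>), and in \<open>t\<close> the factored sum. Each side
  goal is tried as a sign condition first; \<open>fail\<close> sends it on to polynomial
  normalisation if it is not closed.\<close>

lemma inside_etc20: "inside_angle_A (bary_of etc20 a b b)"
  unfolding etc20_def
  by (rule inside_angle_A_neg[
      where p="3*a^4 - 4*a^2*b^2" and q="-(a^4)" and r="1" and s="1"
        and t="a^2*(a^2 - 4*b^2)"];
    ((insert ab sides_less, simp add: side_bounds mult_less_0_iff zero_less_mult_iff; fail) |
      (simp add: power2_eq_square power3_eq_cube power4_eq_xxxx algebra_simps)))

text \<open>All coordinates vanish for \<open>a = b\<close>, and their sum does so to second order,
  which fixes its sign; likewise for X(36) and X(44).\<close>

lemma inside_etc23: "inside_angle_A (bary_of etc23 a b b)"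
  unfolding etc23_def
  by (rule inside_angle_A_neg[
      where p="a^2*(b^4 - a^4)" and q="a^2*b^2*(a^2 - b^2)" and r="1" and s="1"
        and t="-(a^2*(b^2 - a^2)^2)"];
    ((insert ab sides_less, simp add: side_bounds mult_less_0_iff zero_less_mult_iff; fail) |
      (simp add: power2_eq_square power3_eq_cube power4_eq_xxxx algebra_simps)))

lemma inside_etc36: "inside_angle_A (bary_of etc36 a b b)"
  unfolding etc36_def
  by (rule inside_angle_A_neg[
      where p="a^2*(b^2 - a^2)" and q="a*b^2*(a - b)" and r="1" and s="1"
        and t="a*(a - b)^2*(-(a + 2*b))"];
    ((insert ab sides_less, simp add: side_bounds mult_less_0_iff zero_less_mult_iff; fail) |
      (simp add: power2_eq_square power3_eq_cube power4_eq_xxxx algebra_simps)))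

lemma inside_etc40: "inside_angle_A (bary_of etc40 a b b)"
  unfolding etc40_def
  by (rule inside_angle_A_neg[
      where p="a^4 + 2*a^3*b - 4*a^2*b^2" and q="-(a^3*b)" and r="1" and s="1"
        and t="a^2*(a^2 - 4*b^2)"];
    ((insert ab sides_less, simp add: side_bounds mult_less_0_iff zero_less_mult_iff; fail) |
      (simp add: power2_eq_square power3_eq_cube power4_eq_xxxx algebra_simps)))

text \<open>The coordinate at A has the sign of \<open>2*a - b\<close>, which varies, but the sum
  stays positive.\<close>

lemma inside_etc43: "inside_angle_A (bary_of etc43 a b b)"
  unfolding etc43_def
  by (rule inside_angle_A_pos[
      where p="a*b*(2*a - b)" and q="b^3" and r="1" and s="1"
        and t="b*(2*a^2 + 2*b^2 - a*b)"];
    ((insert ab sides_less, simp add: side_bounds mult_less_0_iff zero_less_mult_iff; fail) |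
      (simp add: power2_eq_square power3_eq_cube power4_eq_xxxx algebra_simps)))

lemma inside_etc44: "inside_angle_A (bary_of etc44 a b b)"
  unfolding etc44_def
  by (rule inside_angle_A_neg[
      where p="2*a*(b - a)" and q="b*(a - b)" and r="1" and s="1"
        and t="-(2*(b - a)^2)"];
    ((insert ab sides_less, simp add: side_bounds mult_less_0_iff zero_less_mult_iff; fail) |
      (simp add: power2_eq_square power3_eq_cube power4_eq_xxxx algebra_simps)))

text \<open>Here \<open>r\<close> and \<open>s\<close> have opposite signs, so the terms of
  \<open>p s + 2 q r\<close> compete. Both vanish for \<open>a = b\<close>, and dividing out that
  common factor leaves one of fixed sign. X(74), X(80), X(88) and X(98) behave alike.\<close>

lemma inside_etc67: "inside_angle_A (bary_of etc67 a b b)"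
  unfolding etc67_def
  by (rule inside_angle_A_pos[
      where p="1" and q="1" and r="b^4 - a^4" and s="a^2*(a^2 - b^2)"
        and t="(b^2 - a^2)*(2*b^2 + a^2)"];
    ((insert ab sides_less, simp add: side_bounds mult_less_0_iff zero_less_mult_iff; fail) |
      (simp add: power2_eq_square power3_eq_cube power4_eq_xxxx algebra_simps)))

lemma inside_etc74: "inside_angle_A (bary_of etc74 a b b)"
  unfolding etc74_def
  by (rule inside_angle_A_neg[
      where p="a^2" and q="b^2" and r="2*a^2*(a^2 - b^2)" and s="a^2*(b^2 - a^2)"
        and t="a^2*(b^2 - a^2)*(a^2 - 4*b^2)"];
    ((insert ab sides_less, simp add: side_bounds mult_less_0_iff zero_less_mult_iff; fail) |
      (simp add: power2_eq_square power3_eq_cube power4_eq_xxxx algebra_simps)))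

lemma inside_etc80: "inside_angle_A (bary_of etc80 a b b)"
  unfolding etc80_def
  by (rule inside_angle_A_pos[
      where p="1" and q="1" and r="b^2 - a^2" and s="a*(a - b)"
        and t="(b - a)*(2*b + a)"];
    ((insert ab sides_less, simp add: side_bounds mult_less_0_iff zero_less_mult_iff; fail) |
      (simp add: power2_eq_square power3_eq_cube power4_eq_xxxx algebra_simps)))

lemma inside_etc88: "inside_angle_A (bary_of etc88 a b b)"
  unfolding etc88_def
  by (rule inside_angle_A_pos[
      where p="a" and q="b" and r="2*(b - a)" and s="a - b"
        and t="(b - a)*(4*b - a)"];
    ((insert ab sides_less, simp add: side_bounds mult_less_0_iff zero_less_mult_iff; fail) |
      (simp add: power2_eq_square power3_eq_cube power4_eq_xxxx algebra_simps)))

lemma inside_etc98: "inside_angle_A (bary_of etc98 a b b)"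
  unfolding etc98_def
  by (rule inside_angle_A_pos[
      where p="1" and q="1" and r="2*b^2*(b^2 - a^2)" and s="a^2*(a^2 - b^2)"
        and t="(b^2 - a^2)*(4*b^2 - a^2)"];
    ((insert ab sides_less, simp add: side_bounds mult_less_0_iff zero_less_mult_iff; fail) |
      (simp add: power2_eq_square power3_eq_cube power4_eq_xxxx algebra_simps)))

text \<open>The denominators are the numerators of X(20), negative at all three vertices.\<close>

lemma inside_etc64: "inside_angle_A (bary_of etc64 a b b)"
  unfolding etc64_def
  by (rule inside_angle_A_neg_denominators[where r="a^2*(3*a^2 - 4*b^2)" and s="-(a^4)"];
    ((insert ab sides_less, simp add: side_bounds mult_less_0_iff; fail) |
      (simp add: power2_eq_square power3_eq_cube power4_eq_xxxx algebra_simps)))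

lemma inside_etc84: "inside_angle_A (bary_of etc84 a b b)"
  unfolding etc84_def
  by (rule inside_angle_A_neg_denominators[where r="a*(a^2 + 2*a*b - 4*b^2)" and s="-(a^3)"];
    ((insert ab sides_less, simp add: side_bounds mult_less_0_iff; fail) |
      (simp add: power2_eq_square power3_eq_cube power4_eq_xxxx algebra_simps)))

end

section \<open>Centres given by the angles, in terms of the base angle\<close>

context
  fixes a b \<theta> k m c \<sigma> d e :: real
  assumes b_pos: "0 < b" and theta: "pi / 3 < \<theta>" "\<theta> < pi / 2"
    and k_def: "k = cos \<theta>" and m_def: "m = cos (pi - 2 * \<theta>)"
    and c_def: "c = cos (3 * \<theta>)" and \<sigma>_def: "\<sigma> = sin (3 * \<theta>)"
    and d_def: "d = sin (\<theta> - pi / 3)" and e_def: "e = cos (\<theta> - pi / 3)"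
    and a_eq: "a = 2 * b * k"
begin

lemma k_bounds: "0 < k" "k < 1 / 2" "k^2 < 1 / 4"
proof -
  show "0 < k"
    unfolding k_def using theta by (intro cos_gt_zero_pi) auto
  show less: "k < 1 / 2"
    unfolding k_def using theta cos_monotone_0_pi[of "pi / 3" \<theta>] by (simp add: cos_60)
  show "k^2 < 1 / 4"
    using power_strict_mono[OF less, of 2] \<open>0 < k\<close> by (simp add: power_divide)
qed

lemma sides: "0 < a" "a < b" "0 < b"
  using b_pos k_bounds by (auto simp: a_eq)

lemma m_eq: "m = 1 - 2 * k^2"
  by (simp add: m_def k_def cos_double_cos)

lemma c_eq: "c = 4 * k^3 - 3 * k"
  unfolding c_def k_def by (rule cos_treble_cos)

lemma angles: "angA a b b = pi - 2 * \<theta>" "angA b b a = \<theta>" "angA b a b = \<theta>"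
proof -
  have "(b^2 + b^2 - a^2) / (2 * b * b) = m"
    using b_pos by (simp add: a_eq m_eq field_simps power2_eq_square)
  then show "angA a b b = pi - 2 * \<theta>"
    \<comment> \<open>Dropping \<open>cos_pi_minus\<close> keeps the argument of
      \<open>arccos\<close> a cosine of the angle sought.\<close>
    using theta unfolding angA_def m_def by (simp add: arccos_cos del: cos_pi_minus)
  have "(b^2 + a^2 - b^2) / (2 * b * a) = cos \<theta>" "(a^2 + b^2 - b^2) / (2 * a * b) = cos \<theta>"
    using k_bounds sides by (simp_all add: a_eq power2_eq_square flip: k_def)
  then show "angA b b a = \<theta>" "angA b a b = \<theta>"
    using theta unfolding angA_def by (simp_all add: arccos_cos)
qed

text \<open>All angles are reduced to multiples of \<theta> and of \<open>\<theta> - pi/3\<close>,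
  using \<open>A - pi/3 = -2 (\<theta> - pi/3)\<close>. Here \<open>c\<close> is a cosine, not a
  side.\<close>

lemma angle_values:
  "cos \<theta> = k" "cos (pi - 2 * \<theta>) = m" "cos (2 * \<theta>) = - m" "cos (2 * (pi - 2 * \<theta>)) = 2 * m^2 - 1"
  "cos (3 * \<theta>) = c" "sin (3 * \<theta>) = \<sigma>" "sin (\<theta> - pi / 3) = d"
  "cos (3 * (pi - 2 * \<theta>)) = 1 - 2 * c^2" "sin (3 * (pi - 2 * \<theta>)) = 2 * \<sigma> * c"
  "cos (\<theta> - (pi - 2 * \<theta>)) = - c" "cos (pi - 2 * \<theta> - \<theta>) = - c"
  "sin (pi - 2 * \<theta> - pi / 3) = - 2 * d * e"
proof -
  show "cos \<theta> = k" "cos (pi - 2 * \<theta>) = m" "cos (2 * \<theta>) = - m"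
    "cos (3 * \<theta>) = c" "sin (3 * \<theta>) = \<sigma>" "sin (\<theta> - pi / 3) = d"
    by (simp_all add: k_def m_def c_def \<sigma>_def d_def)
  show "cos (2 * (pi - 2 * \<theta>)) = 2 * m^2 - 1"
    unfolding m_def by (rule cos_double_cos)
  have "3 * (pi - 2 * \<theta>) = pi - 2 * (3 * \<theta>) + 2 * pi"
    by simp
  then show "cos (3 * (pi - 2 * \<theta>)) = 1 - 2 * c^2" "sin (3 * (pi - 2 * \<theta>)) = 2 * \<sigma> * c"
    by (simp_all only: c_def \<sigma>_def cos_periodic sin_periodic cos_pi_minus sin_pi_minus
        cos_double_cos sin_double minus_diff_eq)
  have "\<theta> - (pi - 2 * \<theta>) = - (pi - 3 * \<theta>)" "pi - 2 * \<theta> - \<theta> = pi - 3 * \<theta>"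
    by simp_all
  then show "cos (\<theta> - (pi - 2 * \<theta>)) = - c" "cos (pi - 2 * \<theta> - \<theta>) = - c"
    by (simp_all only: c_def cos_minus cos_pi_minus)
  have "pi - 2 * \<theta> - pi / 3 = - (2 * (\<theta> - pi / 3))"
    by simp
  then show "sin (pi - 2 * \<theta> - pi / 3) = - 2 * d * e"
    by (simp only: d_def e_def sin_minus sin_double)
qed

lemma value_bounds:
  "0 < k" "k < 1 / 2" "k^2 < 1 / 4" "0 < m" "m < 1" "c < 0" "\<sigma> < 0" "0 < d" "1 / 2 < e" "2
    * k * e < 1"
proof -
  show "0 < k" "k < 1 / 2" "k^2 < 1 / 4" "0 < m" "m < 1"
    using k_bounds by (auto simp: m_eq)
  \<comment> \<open>Since \<open>pi < 3\<theta> < 3 pi/2\<close>, the shifted angle is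
    acute.\<close>
  have "0 < cos (3 * \<theta> - pi)" "0 < sin (3 * \<theta> - pi)"
    using theta by (auto intro!: cos_gt_zero_pi sin_gt_zero simp del: cos_minus_pi sin_minus_pi)
  then show "c < 0" "\<sigma> < 0"
    by (simp_all add: c_def \<sigma>_def)
  show "0 < d"
    unfolding d_def using theta by (intro sin_gt_zero) auto
  show half: "1 / 2 < e"
    unfolding e_def using theta cos_monotone_0_pi[of "\<theta> - pi / 3" "pi / 3"] by (simp add: cos_60)
  have "2 * k * e < 1 * e"
    using k_bounds half by (intro mult_strict_right_mono) auto
  also have "e \<le> 1"
    unfolding e_def by simp
  finally show "2 * k * e < 1"
    by simp
qed

text \<open>The angles are acute and stay below \<open>pi\<close> when \<open>pi/3\<close> or
  \<open>pi/6\<close> is added; the cosine of the difference between A and a base angle is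
  \<open>- c > 0\<close>.\<close>

lemma inside_nonneg_trig_entries:
  "\<forall>e\<in>{etc13, etc15, etc17, etc29, etc33, etc48, etc53, etc54, etc61, etc77, etc92,
    etc97}. inside_angle_A (bary_of e a b b)"
  unfolding ball_simps etc13_def etc15_def etc17_def etc29_def etc33_def etc48_def etc53_def
    etc54_def etc61_def etc77_def etc92_def etc97_def
  by (intro conjI TrueI; rule inside_angle_A_nonneg; (simp only: angles angle_values)?;
    insert theta sides value_bounds pi_gt_zero;
    (intro less_imp_le mult_pos_pos add_pos_pos divide_pos_pos sin_gt_zero cos_gt_zero_pi
      tan_gt_zero)?;
    (linarith | simp add: algebra_simps))

text \<open>As \<open>A < pi/3 < \<theta>\<close>, the sines at A and at B have opposite signs;
  \<open>k < 1/2 < e\<close> decides the sum. The identities here and below follow from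
  \<open>a = 2 b k\<close>, \<open>m = 1 - 2 k^2\<close> and \<open>c = 4 k^3 - 3 k\<close>.\<close>

lemma inside_etc14: "inside_angle_A (bary_of etc14 a b b)"
  unfolding etc14_def
  by (rule inside_angle_A_neg[
      where p="a" and q="b" and r="-2*d*e" and s="d"
        and t="2*b*d*(k - 2*e)"];
    (simp only: angles angle_values)?;
    ((insert sides value_bounds, simp add: mult_less_0_iff zero_less_mult_iff add_nonneg_pos
      add_pos_pos; fail) |
      (use a_eq m_eq c_eq in algebra)))

lemma inside_etc16: "inside_angle_A (bary_of etc16 a b b)"
  unfolding etc16_def
  by (rule inside_angle_A_pos[
      where p="a*(-2*d*e)" and q="b*d" and r="1" and s="1"
        and t="2*b*d*(1 - 2*k*e)"];
    (simp only: angles angle_values)?;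
    ((insert sides value_bounds, simp add: mult_less_0_iff zero_less_mult_iff add_nonneg_pos
      add_pos_pos; fail) |
      (use a_eq m_eq c_eq in algebra)))

lemma inside_etc24: "inside_angle_A (bary_of etc24 a b b)"
  unfolding etc24_def
  by (rule inside_angle_A_neg[
      where p="a*(2*m^2 - 1)" and q="-(b*m)" and r="m" and s="k"
        and t="-(2*b*(k^2 + m^3))"];
    (simp only: angles angle_values)?;
    ((insert sides value_bounds, simp add: mult_less_0_iff zero_less_mult_iff add_nonneg_pos
      add_pos_pos; fail) |
      (use a_eq m_eq c_eq in algebra)))

lemma inside_etc46: "inside_angle_A (bary_of etc46 a b b)"
  unfolding etc46_def
  by (rule inside_angle_A_pos[
      where p="a*(2*k - m)" and q="b*m" and r="1" and s="1"
        and t="2*b*(2*k^2 + m*(1 - k))"];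
    (simp only: angles angle_values)?;
    ((insert sides value_bounds, simp add: mult_less_0_iff zero_less_mult_iff add_nonneg_pos
      add_pos_pos; fail) |
      (use a_eq m_eq c_eq in algebra)))

lemma inside_etc47: "inside_angle_A (bary_of etc47 a b b)"
  unfolding etc47_def
  by (rule inside_angle_A_neg[
      where p="a*(2*m^2 - 1)" and q="-(b*m)" and r="1" and s="1"
        and t="-(2*b*(k*(1-m)*(2*m+1) + m*(1-k)))"];
    (simp only: angles angle_values)?;
    ((insert sides value_bounds, simp add: mult_less_0_iff zero_less_mult_iff add_nonneg_pos
      add_pos_pos; fail) |
      (use a_eq m_eq c_eq in algebra)))

text \<open>The treble angle formula gives \<open>2 b c = a (4 k^2 - 3)\<close>, so the factor
  \<open>a\<close> splits off the sum.\<close>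

lemma inside_etc49: "inside_angle_A (bary_of etc49 a b b)"
  unfolding etc49_def
  by (rule inside_angle_A_neg[
      where p="a*(1 - 2*c^2)" and q="b*c" and r="1" and s="1"
        and t="-(2*a*(1 - 2*k^2 + c^2))"];
    (simp only: angles angle_values)?;
    ((insert sides value_bounds, simp add: mult_less_0_iff zero_less_mult_iff add_nonneg_pos
      add_pos_pos; fail) |
      (use a_eq m_eq c_eq in algebra)))

lemma inside_etc50: "inside_angle_A (bary_of etc50 a b b)"
  unfolding etc50_def
  by (rule inside_angle_A_neg[
      where p="a*(2*\<sigma>*c)" and q="b*\<sigma>" and r="1" and s="1"
        and t="2*b*\<sigma>*((1 - 4*k^2)*(1 - 2*k^2))"];
    (simp only: angles angle_values)?;
    ((insert sides value_bounds, simp add: mult_less_0_iff zero_less_mult_iff add_nonneg_pos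
      add_pos_pos; fail) |
      (use a_eq m_eq c_eq in algebra)))

lemma inside_etc52: "inside_angle_A (bary_of etc52 a b b)"
  unfolding etc52_def
  by (rule inside_angle_A_neg[
      where p="a*(2*m^2 - 1)" and q="b*m*c" and r="1" and s="1"
        and t="-(2*a*(1 - k^2))"];
    (simp only: angles angle_values)?;
    ((insert sides value_bounds, simp add: mult_less_0_iff zero_less_mult_iff add_nonneg_pos
      add_pos_pos; fail) |
      (use a_eq m_eq c_eq in algebra)))

lemma inside_etc94: "inside_angle_A (bary_of etc94 a b b)"
  unfolding etc94_def
  by (rule inside_angle_A_pos[
      where p="a" and q="b" and r="2*\<sigma>*c" and s="\<sigma>"
        and t="a*(-\<sigma>)*(5 - 8*k^2)"];
    (simp only: angles angle_values)?;
    ((insert sides value_bounds, simp add: mult_less_0_iff zero_less_mult_iff add_nonneg_pos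
      add_pos_pos; fail) |
      (use a_eq m_eq c_eq in algebra)))

lemma inside_etc34: "inside_angle_A (bary_of etc34 a b b)"
proof -
  have "a * (1 - 1 / m) < 0" "b * (1 - 1 / k) < 0"
    using value_bounds sides by (auto intro!: mult_pos_neg)
  then show ?thesis
    unfolding etc34_def
    by (intro inside_angle_A_neg[OF refl refl _ refl refl _ _ refl];
      (simp only: angles angle_values)?; simp)
qed

lemma inside_etc78: "inside_angle_A (bary_of etc78 a b b)"
  unfolding etc78_def
  by (intro inside_angle_A_neg_denominators[OF _ refl refl];
    (simp only: angles angle_values)?; insert sides value_bounds; simp)

text \<open>The sine at A changes sign at \<open>A = pi/6\<close>, but the bound \<open>-1\<close>
  suffices: the sum exceeds \<open>b - a\<close>.\<close>

lemma inside_etc62: "inside_angle_A (bary_of etc62 a b b)"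
proof -
  have half: "1 / 2 < sin (\<theta> - pi / 6)"
    using theta sin_monotone_2pi[of "pi / 6" "\<theta> - pi / 6"] by (simp add: sin_30)
  have "a * (- 1) \<le> a * sin (pi - 2 * \<theta> - pi / 6)"
    using sides by (intro mult_left_mono) auto
  moreover have "b * (1 / 2) < b * sin (\<theta> - pi / 6)"
    using b_pos half by (intro mult_strict_left_mono) auto
  ultimately have "0 < a * sin (pi - 2 * \<theta> - pi / 6) + 2 * (b * sin (\<theta> - pi / 6))"
    using sides by linarith
  with half b_pos show ?thesis
    unfolding etc62_def
    by (intro inside_angle_A_pos[OF refl refl _ refl refl _ _ refl];
      (simp only: angles)?; simp)
qed

end

section \<open>From sides to the base angle, and collection of the cases\<close>

lemma isosceles_base_angle:
  fixes a b :: real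
  assumes "0 < a" "a < b"
  obtains \<theta> where "pi / 3 < \<theta>" "\<theta> < pi / 2" "a = 2 * b * cos \<theta>"
proof
  have "arccos (1 / 2) = pi / 3"
    using arccos_cos[of "pi / 3"] by (simp add: cos_60)
  moreover have "arccos (1 / 2) < arccos (a / (2 * b))" "arccos (a / (2 * b)) < arccos 0"
    using assms by (intro arccos_less_arccos; simp add: field_simps)+
  ultimately show "pi / 3 < arccos (a / (2 * b))" "arccos (a / (2 * b)) < pi / 2"
    unfolding arccos_0 by linarith+
  show "a = 2 * b * cos (arccos (a / (2 * b)))"
    using assms by (simp add: cos_arccos field_simps)
qed

lemma inside_entries:
  assumes "0 < a" "a < b" "n \<in> {1..100} - {18,26,30,59,68,70,87,90,91,93,96,99,100}"
  shows "inside_angle_A (bary_of (etc_table ! (n - 1)) a b b)"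
proof -
  obtain \<theta> where "pi / 3 < \<theta>" "\<theta> < pi / 2" "a = 2 * b * cos \<theta>"
    using isosceles_base_angle[OF assms(1,2)] .
  moreover have "0 < b"
    using assms(1,2) by simp
  ultimately have angle: "0 < b" "pi / 3 < \<theta>" "\<theta> < pi / 2" "a = 2 * b * cos \<theta>"
    by auto
  note trig = angle(1-3) refl refl refl refl refl refl angle(4)
  let ?S = "{18,26,30,59,68,70,87,90,91,93,96,99,100} :: nat set"
  \<comment> \<open>Enumerating from 1 pairs each entry with its ETC index, so that simplification
    meets only concrete numerals.\<close>
  have "\<forall>(n, e) \<in> set (enumerate 1 etc_table). n \<notin> ?S \<longrightarrow> inside_angle_A (bary_of e a b b)"
    unfolding etc_table_def
    using inside_nonneg_entries[OF assms(1,2)] inside_nonneg_trig_entries[OF trig]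
    inside_etc20[OF assms(1,2)] inside_etc23[OF assms(1,2)] inside_etc36[OF assms(1,2)]
      inside_etc40[OF assms(1,2)] inside_etc43[OF assms(1,2)] inside_etc44[OF assms(1,2)]
      inside_etc64[OF assms(1,2)] inside_etc67[OF assms(1,2)] inside_etc74[OF assms(1,2)]
      inside_etc80[OF assms(1,2)] inside_etc84[OF assms(1,2)] inside_etc88[OF assms(1,2)]
      inside_etc98[OF assms(1,2)]
    inside_etc14[OF trig] inside_etc16[OF trig] inside_etc24[OF trig] inside_etc34[OF trig]
      inside_etc46[OF trig] inside_etc47[OF trig] inside_etc49[OF trig] inside_etc50[OF trig]
      inside_etc52[OF trig] inside_etc62[OF trig] inside_etc78[OF trig] inside_etc94[OF trig]
    by simp
  moreover have "length etc_table = 100"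
    by (simp add: etc_table_def)
  then have "(n, etc_table ! (n - 1)) \<in> set (enumerate 1 etc_table)"
    using assms(3) by (auto simp: in_set_enumerate_eq)
  ultimately show ?thesis
    using assms(3) by blast
qed

section \<open>The exceptional centres\<close>

text \<open>The denominator at A has a factor \<open>b - c\<close>, hence is zero in every isosceles
  triangle considered.\<close>

lemma outside_every_isosceles:
  "\<forall>e\<in>{etc59, etc99, etc100}. \<not> inside_angle_A (bary_of e a b b)"
  unfolding ball_simps etc59_def etc99_def etc100_def
  by (intro conjI TrueI not_inside_angle_A) simp_all

text \<open>X(30) is a point at infinity: its coordinates sum to zero.\<close>

lemma outside_etc30: "\<not> inside_angle_A (bary_of etc30 a b b)"
proof -
  have "2 * a^4 - a^2 * (b^2 + b^2) - (b^2 - b^2)^2 + (2 * b^4 - b^2 * (b^2 + a^2) - (b^2 - a^2)^2)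
    + (2 * b^4 - b^2 * (a^2 + b^2) - (a^2 - b^2)^2) = 0"
    by (simp add: power2_eq_square power4_eq_xxxx algebra_simps)
  then show ?thesis
    unfolding inside_angle_A_def bary_of_def etc30_def Let_def fst_conv snd_conv prod.case
      mult_1_right
    by simp
qed

text \<open>The denominator at A is \<open>b (2 a - b)\<close>, which vanishes for
  \<open>b = 2 a\<close>.\<close>

lemma outside_etc87: "\<not> inside_angle_A (bary_of etc87 1 2 2)"
  unfolding etc87_def by (rule not_inside_angle_A) simp

text \<open>The first denominator of X(90) vanishes when \<open>2 cos B = cos A\<close>, that is,
  \<open>2 cos B = sqrt 3 - 1\<close>.\<close>

lemma outside_etc90: "\<exists>a b. 0 < a \<and> a < b \<and> \<not> inside_angle_A (bary_of etc90 a b b)"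
proof -
  have sqrt_3: "0 < sqrt 3 - (1::real)" "sqrt 3 - 1 < (1::real)"
    using real_less_rsqrt[of 1 3] real_less_lsqrt[of 2 3] by auto
  then obtain \<theta> where \<theta>: "pi / 3 < \<theta>" "\<theta> < pi / 2" "sqrt 3 - 1 = 2 * 1 * cos \<theta>"
    using isosceles_base_angle[of "sqrt 3 - 1" 1] by auto
  note ang = angles[OF zero_less_one \<theta>(1,2) refl refl refl refl refl refl \<theta>(3)]
  have c: "cos \<theta> = (sqrt 3 - 1) / 2"
    using \<theta>(3) by simp
  have "2 * cos \<theta> + cos (2 * \<theta>) = 0"
    unfolding cos_double_cos c by (simp add: power2_eq_square field_simps)
  then have "\<not> inside_angle_A (bary_of etc90 (sqrt 3 - 1) 1 1)"
    unfolding etc90_def by (intro not_inside_angle_A) (simp add: ang)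
  with sqrt_3 show ?thesis
    by blast
qed

text \<open>With \<open>A = pi/6\<close>, that is \<open>\<theta> = 5 pi/12\<close>, both
  \<open>sin (A - pi/6)\<close> and \<open>cos (3 A)\<close> are zero, and these are the
  denominators at A.\<close>

lemma outside_apex_30:
  "\<forall>e\<in>{etc18, etc93}. \<exists>a b. 0 < a \<and> a < b \<and> \<not> inside_angle_A (bary_of e a b b)"
proof -
  have \<theta>: "pi / 3 < 5 * pi / 12" "5 * pi / 12 < pi / 2"
    by simp_all
  define a where "a = 2 * 1 * cos (5 * pi / 12)"
  note triangle = zero_less_one \<theta> refl refl refl refl refl refl a_def
  have apex: "angA a 1 1 = pi / 6"
    using angles(1)[OF triangle] by simp
  have "cos (3 * (pi / 6)) = 0" "sin (pi / 6 - pi / 6) = 0"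
    by simp_all
  then have "\<forall>e\<in>{etc18, etc93}. \<not> inside_angle_A (bary_of e a 1 1)"
    unfolding ball_simps etc18_def etc93_def
    by (intro conjI TrueI not_inside_angle_A) (simp_all only: apex mult_zero_right)
  with sides(1,2)[OF triangle] show ?thesis
    by blast
qed

text \<open>
  For X(70) it is the denominators at B and C that vanish here, so the cleared triple
  degenerates to \<open>(0, 0, 0)\<close>.
\<close>

lemma outside_apex_45:
  "\<forall>e\<in>{etc26, etc68, etc70, etc91, etc96}. \<exists>a b. 0 < a \<and> a < b \<and> \<not> inside_angle_A (bary_of e a b b)"
proof -
  have \<theta>: "pi / 3 < 3 * pi / 8" "3 * pi / 8 < pi / 2"
    by simp_all
  \<comment> \<open>The base angle \<open>3 pi/8\<close> gives \<open>A = pi/4\<close>, where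
    \<open>cos (2 A) = 0\<close>.\<close>
  define a where "a = 2 * 1 * cos (3 * pi / 8)"
  note triangle = zero_less_one \<theta> refl refl refl refl refl refl a_def
  have apex: "cos (2 * angA a 1 1) = 0"
    unfolding angles(1)[OF triangle] by (simp add: field_simps)
  \<comment> \<open>Equal base angles cancel in the bracket of X(26) and X(70) at B, leaving only
    \<open>a^2 cos (2 A)\<close>.\<close>
  have base: "angA 1 1 a = angA 1 a 1"
    using angles(2,3)[OF triangle] by simp
  have "\<forall>e\<in>{etc26, etc68, etc70, etc91, etc96}. \<not> inside_angle_A (bary_of e a 1 1)"
    unfolding ball_simps etc26_def etc68_def etc70_def etc91_def etc96_def
    by (intro conjI TrueI not_inside_angle_A) (simp_all add: apex base)
  with sides(1,2)[OF triangle] show ?thesis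
    by blast
qed

theorem theorem2p4:
  shows "(\<forall>n \<in> {1..100} - {18,26,30,59,68,70,87,90,91,93,96,99,100::nat}.
            \<forall>a b c :: real. 0 < a \<and> a < b \<and> b = c \<longrightarrow> inside_angle_A (ETC n a b c))
       \<and> (\<forall>n \<in> {18,26,30,59,68,70,87,90,91,93,96,99,100::nat}.
            \<not> (\<forall>a b c :: real. 0 < a \<and> a < b \<and> b = c \<longrightarrow> inside_angle_A (ETC n a b c)))"
proof (intro conjI ballI allI impI)
  fix n :: nat and a b c :: real
  assume "n \<in> {1..100} - {18,26,30,59,68,70,87,90,91,93,96,99,100}" "0 < a \<and> a < b \<and> b = c"
  then show "inside_angle_A (ETC n a b c)"
    using inside_entries[of a b n] by (simp add: ETC_def)
next
  fix n :: nat
  assume n: "n \<in> {18,26,30,59,68,70,87,90,91,93,96,99,100}"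
  let ?outside = "\<lambda>e. \<exists>a b. 0 < a \<and> a < b \<and> \<not> inside_angle_A (bary_of e a b b)"
  \<comment> \<open>The triangle 1, 2, 2 chosen for X(87) also serves X(30), X(59), X(99) and
    X(100), which fail in every isosceles triangle.\<close>
  have "(0::real) < 1 \<and> (1::real) < 2"
    by simp
  then have "?outside etc30" "?outside etc59" "?outside etc87" "?outside etc99" "?outside etc100"
    using outside_etc30[of 1 2] outside_etc87 outside_every_isosceles[of 1 2]
    unfolding ball_simps by blast+
  then have "?outside (etc_table ! (n - 1))"
    using n outside_apex_30 outside_apex_45 outside_etc90
    unfolding ball_simps insert_iff empty_iff etc_table_def
    by (elim disjE FalseE) simp_all
  then show "\<not> (\<forall>a b c. 0 < a \<and> a < b \<and> b = c \<longrightarrow> inside_angle_A (ETC n a b c))"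
    unfolding ETC_def by blast
qed

end
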